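(* Let $c,\phi\in\mathbb{R}\setminus\{0\}$ and let $K(s)$ be a continuous function on an interval containing $s_0$. There exists a 2-parameter family of helicoidal surfaces of ni-type in $\mathbb{I}^3$ with $K$ as the Gaussian curvature (i.e. the Gaussian curvature at the point with parameters $(s,t)$ is $K(s)$) and whose generating curves $\alpha_{k_0,k_1}(s)=(x(s),y(s),0)$, where $s$ is the arc-length parameter ($x'^2+y'^2=1$), are implicitly given, on intervals around $s_0$ where the expression makes sense, by $$x^2(s)+y^2(s)=k_0+2\int_{s_0}^{s}\left(k_1+\frac{3\phi^2}{c^2}\int_{s_0}^{v}K(w)\,dw\right)^{-\frac13}dv,$$ where $k_0,k_1$ are constants depending on the values of $x,y,x',y'$ at $s=s_0$.
   Context: The simply isotropic space $\mathbb{I}^3$ is $\mathbb{R}^3$ with the degenerate metric $\langle u,v\rangle_z=u^1v^1+u^2v^2$. For a $C^2$ parameterized surface $\mathbf{x}(u^1,u^2)=(x^1,x^2,x^3)$ write $\mathbf{x}_i=\partial\mathbf{x}/\partial u^i$, $\mathbf{x}_{ij}=\partial^2\mathbf{x}/\partial u^i\partial u^j$, $x^i_k=\partial x^i/\partial u^k$, $X_{ij}=x^i_1x^j_2-x^j_1x^i_2$. The surface is admissible if $X_{12}\neq0$ (equivalently, the induced metric has rank 2). Put $g_{ij}=\langle\mathbf{x}_i,\mathbf{x}_j\rangle_z$, $N_h=\left(\frac{X_{23}}{X_{12}},\frac{X_{31}}{X_{12}},1\right)$, $h_{ij}=\langle N_h,\mathbf{x}_{ij}\rangle$ (Euclidean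 inner product). The Gaussian and mean curvatures are $$K=\frac{h_{11}h_{22}-h_{12}^2}{g_{11}g_{22}-g_{12}^2},\qquad H=\frac12\,\frac{g_{11}h_{22}-2g_{12}h_{12}+g_{22}h_{11}}{g_{11}g_{22}-g_{12}^2};$$ equivalently $K=\det L$, $H=\frac12\mathrm{tr}\,L$ with $L=-D\xi$, $\xi=\left(A,B,\frac12(1-A^2-B^2)\right)$, $A=X_{23}/X_{12}$, $B=X_{31}/X_{12}$. The helicoidal surface of ni-type with generating curve $\alpha(u)=(x(u),y(u),0)$ (a $C^2$ curve) and parameters $c,\phi$ is $$Y_2(u,t)=(x(u)\cos(t\phi)-y(u)\sin(t\phi),\ x(u)\sin(t\phi)+y(u)\cos(t\phi),\ ct),$$ with coordinates $(u^1,u^2)=(u,t)$. Surfaces are assumed admissible, which here means $\phi(xx'+yy')\neq0$. For negative numbers, $(\cdot)^{-1/3}$ denotes the real cube root of the reciprocal.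
   Formalization: "Makes sense" is taken to require, besides a nonzero radicand, that the square of its reciprocal cube root (the value of xx'+yy') be strictly less than the right-hand side; otherwise no unit-speed curve need exist (K=0, k_0=0, k_1=1). *)

theory Defs
  imports "HOL-Analysis.Analysis"
begin

text \<open>Partial derivatives of a map on a parameter domain \<open>D\<close>, taken within the slices of \<open>D\<close>
  parallel to the axes: the usual partial derivatives at interior points of the slices, and
  one-sided ones at their end points.\<close>

definition pd1 ::
  "(real \<times> real) set \<Rightarrow> (real \<times> real \<Rightarrow> 'a::real_normed_vector) \<Rightarrow> real \<times> real \<Rightarrow> 'a" where
  "pd1 D f p = vector_derivative (\<lambda>u. f (u, snd p)) (at (fst p) within {u. (u, snd p) \<in> D})"

definition pd2 ::
  "(real \<times> real) set \<Rightarrow> (real \<times> real \<Rightarrow> 'a::real_normed_vector) \<Rightarrow> real \<times> real \<Rightarrow> 'a" where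
  "pd2 D f p = vector_derivative (\<lambda>v. f (fst p, v)) (at (snd p) within {v. (fst p, v) \<in> D})"

definition iso_inner :: "real^3 \<Rightarrow> real^3 \<Rightarrow> real" where
  "iso_inner u v = u $ 1 * v $ 1 + u $ 2 * v $ 2"

text \<open>\<open>jac D X i j\<close> is the minor \<open>X\<^sub>i\<^sub>j = x\<^sup>i\<^sub>1 x\<^sup>j\<^sub>2 - x\<^sup>j\<^sub>1 x\<^sup>i\<^sub>2\<close> of the Jacobian matrix.\<close>

definition jac ::
  "(real \<times> real) set \<Rightarrow> (real \<times> real \<Rightarrow> real^3) \<Rightarrow> 3 \<Rightarrow> 3 \<Rightarrow> real \<times> real \<Rightarrow> real" where
  "jac D X i j p = pd1 D X p $ i * pd2 D X p $ j - pd1 D X p $ j * pd2 D X p $ i"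

definition iso_admissible :: "(real \<times> real) set \<Rightarrow> (real \<times> real \<Rightarrow> real^3) \<Rightarrow> bool" where
  "iso_admissible D X \<longleftrightarrow> (\<forall>p\<in>D. jac D X 1 2 p \<noteq> 0)"

definition iso_normal ::
  "(real \<times> real) set \<Rightarrow> (real \<times> real \<Rightarrow> real^3) \<Rightarrow> real \<times> real \<Rightarrow> real^3" where
  "iso_normal D X p = vector [jac D X 2 3 p / jac D X 1 2 p, jac D X 3 1 p / jac D X 1 2 p, 1]"

definition iso_gauss_curvature ::
  "(real \<times> real) set \<Rightarrow> (real \<times> real \<Rightarrow> real^3) \<Rightarrow> real \<times> real \<Rightarrow> real" where
  "iso_gauss_curvature D X p =
    (let X1 = pd1 D X p; X2 = pd2 D X p; N = iso_normal D X p;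
         g11 = iso_inner X1 X1; g12 = iso_inner X1 X2; g22 = iso_inner X2 X2;
         h11 = N \<bullet> pd1 D (pd1 D X) p;
         h12 = N \<bullet> pd1 D (pd2 D X) p;
         h22 = N \<bullet> pd2 D (pd2 D X) p
     in (h11 * h22 - h12\<^sup>2) / (g11 * g22 - g12\<^sup>2))"

definition helicoidal_ni ::
  "real \<Rightarrow> real \<Rightarrow> (real \<Rightarrow> real) \<Rightarrow> (real \<Rightarrow> real) \<Rightarrow> real \<times> real \<Rightarrow> real^3" where
  "helicoidal_ni c \<phi> x y = (\<lambda>(u, t).
     vector [x u * cos (t * \<phi>) - y u * sin (t * \<phi>),
             x u * sin (t * \<phi>) + y u * cos (t * \<phi>),
             c * t])"

definition C2_on :: "real set \<Rightarrow> (real \<Rightarrow> real) \<Rightarrow> bool" where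
  "C2_on J f \<longleftrightarrow> (\<exists>f' f''.
     (\<forall>s\<in>J. (f has_vector_derivative f' s) (at s within J)) \<and>
     (\<forall>s\<in>J. (f' has_vector_derivative f'' s) (at s within J)) \<and>
     continuous_on J f'')"

definition arclength_param :: "real set \<Rightarrow> (real \<Rightarrow> real) \<Rightarrow> (real \<Rightarrow> real) \<Rightarrow> bool" where
  "arclength_param J x y \<longleftrightarrow>
     (\<forall>s\<in>J. (vector_derivative x (at s within J))\<^sup>2 + (vector_derivative y (at s within J))\<^sup>2 = 1)"

text \<open>The formula for \<open>x\<^sup>2 + y\<^sup>2\<close>. The integrals are oriented (the upper limit may lie below
  \<open>s0\<close>), and \<open>root 3\<close> is the real cube root, also for negative arguments.\<close>

definition radicand ::
  "real \<Rightarrow> real \<Rightarrow> (real \<Rightarrow> real) \<Rightarrow> real \<Rightarrow> real \<Rightarrow> real \<Rightarrow> real" where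
  "radicand c \<phi> K s0 k1 v = k1 + 3 * \<phi>\<^sup>2 / c\<^sup>2 * (LBINT w=s0..v. K w)"

definition radius_sq ::
  "real \<Rightarrow> real \<Rightarrow> (real \<Rightarrow> real) \<Rightarrow> real \<Rightarrow> real \<Rightarrow> real \<Rightarrow> real \<Rightarrow> real" where
  "radius_sq c \<phi> K s0 k0 k1 s =
     k0 + 2 * (LBINT v=s0..s. 1 / root 3 (radicand c \<phi> K s0 k1 v))"

text \<open>A nondegenerate interval \<open>J \<subseteq> I\<close> containing \<open>s0\<close> on which the formula makes sense as a
  description of a unit speed curve. Besides the radicand being nonzero, this involves the
  Cauchy--Schwarz bound \<open>(x x' + y y')\<^sup>2 \<le> x\<^sup>2 + y\<^sup>2\<close>, because \<open>x x' + y y'\<close> is half the derivative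
  of the right-hand side, i.e. the reciprocal cube root. The bound is taken strict: if equality
  holds at some point (position vector parallel to the tangent), a \<open>C\<^sup>2\<close> curve satisfies
  \<open>(x x' + y y')' = 1\<close> there, which for general \<open>K\<close> is incompatible with the formula.\<close>

definition sensible_interval ::
  "real \<Rightarrow> real \<Rightarrow> (real \<Rightarrow> real) \<Rightarrow> real set \<Rightarrow> real \<Rightarrow> real \<Rightarrow> real \<Rightarrow> real set \<Rightarrow> bool" where
  "sensible_interval c \<phi> K I s0 k0 k1 J \<longleftrightarrow>
     is_interval J \<and> J \<subseteq> I \<and> s0 \<in> J \<and> J \<noteq> {s0} \<and>
     (\<forall>s\<in>J. radicand c \<phi> K s0 k1 s \<noteq> 0 \<and>
        (1 / root 3 (radicand c \<phi> K s0 k1 s))\<^sup>2 < radius_sq c \<phi> K s0 k0 k1 s)"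

end

theory Submission
  imports Defs
begin

text \<open>A unit speed curve \<open>(x, y)\<close> with \<open>x\<^sup>2 + y\<^sup>2 = R\<close> is determined, up to rotation and orientation,
  by \<open>R\<close>, as long as the position vector is nowhere tangential: with \<open>p = x x' + y y' = R' / 2\<close> and
  \<open>q = x y' - y x'\<close> one has \<open>p\<^sup>2 + q\<^sup>2 = R\<close>, which gives \<open>q\<close> up to sign, and the polar angle has
  derivative \<open>q / R\<close>.
  If \<open>k = x' y'' - y' x''\<close> is its plane curvature, then \<open>p' = 1 - k q\<close>.

  The helicoidal surface generated by the curve has \<open>X\<^sub>1\<^sub>2 = \<phi> p\<close>, and its Gaussian curvature at the
  point with parameters \<open>(s, t)\<close> is
  \<open>c\<^sup>2 (k q - 1) / (\<phi>\<^sup>2 p\<^sup>4) = - c\<^sup>2 p' / (\<phi>\<^sup>2 p\<^sup>4)\<close>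
  (lemma \<open>helicoidal_ni_curvature\<close>). So the curvature is \<open>K\<close> exactly when \<open>(p\<^sup>-\<^sup>3)' = 3 \<phi>\<^sup>2 K / c\<^sup>2\<close>.
  One integration gives \<open>p\<close> as the reciprocal cube root of the radicand, with \<open>k1 = p(s0)\<^sup>-\<^sup>3\<close>,
  and a second one gives \<open>R\<close>, with \<open>k0 = R(s0)\<close>.

  For existence the computation is run backwards: \<open>p\<close> and \<open>R\<close> are defined by the two integrations,
  \<open>q = sqrt (R - p\<^sup>2)\<close>, and the curve has polar radius \<open>sqrt R\<close> and polar angle \<open>\<integral> q / R\<close>
  (lemma \<open>unit_speed_curve_of_radius\<close>). None of these formulas involves the interval on which the
  curve is considered, which is why a single pair of functions serves all intervals at once.
  The constants \<open>k0\<close> and \<open>k1\<close> are restricted only by the two conditions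
  \<open>k1 \<noteq> 0\<close> and \<open>p(s0)\<^sup>2 < k0\<close>, which by continuity persist near \<open>s0\<close>.\<close>

section \<open>Calculus on intervals of arbitrary type\<close>

lemma is_interval_perfect:
  fixes J :: "real set"
  assumes "is_interval J" "a \<in> J" "J \<noteq> {a}" "s \<in> J"
  shows "at s within J \<noteq> bot"
proof -
  have "J \<noteq> {x}" for x
    using assms(2,3) by blast
  then have "s islimpt J"
    using assms(1,4) by (intro connected_imp_perfect) (auto simp: is_interval_connected_1)
  then show ?thesis
    by (simp add: trivial_limit_within)
qed

lemma has_vector_derivative_vector3:
  fixes f g h :: "real \<Rightarrow> real"
  assumes "(f has_real_derivative f') F" "(g has_real_derivative g') F"
    "(h has_real_derivative h') F"
  shows "((\<lambda>u. vector [f u, g u, h u] :: real^3) has_vector_derivative vector [f', g', h']) F"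
proof -
  have *: "vector [a, b, c] = a *\<^sub>R axis 1 1 + b *\<^sub>R axis 2 1 + c *\<^sub>R (axis 3 1 :: real^3)" for a b c :: real
    by (simp add: vec_eq_iff forall_3 axis_def)
  have "((\<lambda>u. a u *\<^sub>R e) has_vector_derivative a' *\<^sub>R e) F"
    if "(a has_real_derivative a') F" for a a' and e :: "real^3"
    using that bounded_linear.has_vector_derivative[OF bounded_linear_scaleR_left]
    by (auto simp: has_real_derivative_iff_has_vector_derivative)
  then show ?thesis
    unfolding * using assms by (intro has_vector_derivative_add)
qed

text \<open>Reduction to the fundamental theorem on a compact interval: a neighbourhood of \<open>s\<close> in
  \<open>J\<close> is contained in a compact subinterval \<open>{l'..r'}\<close> of \<open>J\<close>, which can be chosen to contain \<open>a\<close>;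
  if \<open>s\<close> is an end point of \<open>J\<close>, then \<open>l'\<close> or \<open>r'\<close> is an end point as well, and the derivative
  is one-sided.\<close>

lemma oriented_integral_has_derivative:
  fixes f :: "real \<Rightarrow> real"
  assumes J: "is_interval J" and "continuous_on J f" and "a \<in> J" "s \<in> J"
  shows "((\<lambda>v. LBINT w=a..v. f w) has_real_derivative f s) (at s within J)"
proof -
  have Jmem: "x \<in> J" if "u \<in> J" "v \<in> J" "u \<le> x" "x \<le> v" for u v x
    using J that unfolding is_interval_1 by blast
  obtain l l' where l: "l < s" "l' \<in> J" "l' \<le> a" "l' \<le> s" "{l<..s} \<inter> J \<subseteq> {l'..}"
  proof (cases "\<exists>u\<in>J. u < s")
    case True
    then obtain u where "u \<in> J" "u < s" by blast
    then show ?thesis using assms by (intro that[of u "min u a"]) (auto simp: min_def)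
  next
    case False
    then show ?thesis using assms by (intro that[of "s - 1" "min s a"]) (auto simp: min_def not_less)
  qed
  obtain r r' where r: "s < r" "r' \<in> J" "a \<le> r'" "s \<le> r'" "{s..<r} \<inter> J \<subseteq> {..r'}"
  proof (cases "\<exists>u\<in>J. s < u")
    case True
    then obtain u where "u \<in> J" "s < u" by blast
    then show ?thesis using assms by (intro that[of u "max u a"]) (auto simp: max_def)
  next
    case False
    then show ?thesis using assms by (intro that[of "s + 1" "max s a"]) (auto simp: max_def not_less)
  qed
  have "at s within J = at s within {l'..r'}"
  proof (rule at_within_nhd)
    show "s \<in> {l<..<r}" "open {l<..<r}" using l r by auto
    show "J \<inter> {l<..<r} - {s} = {l'..r'} \<inter> {l<..<r} - {s}"
    proof (intro equalityI subsetI)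
      fix x assume x: "x \<in> J \<inter> {l<..<r} - {s}"
      then have "x \<in> {l<..s} \<or> x \<in> {s..<r}" by auto
      then show "x \<in> {l'..r'} \<inter> {l<..<r} - {s}"
        using l(2,4,5) r(2,4,5) x by fastforce
    next
      fix x assume "x \<in> {l'..r'} \<inter> {l<..<r} - {s}"
      then show "x \<in> J \<inter> {l<..<r} - {s}" using Jmem[OF l(2) r(2)] by auto
    qed
  qed
  moreover have "((\<lambda>v. LBINT w=a..v. f w) has_vector_derivative f s) (at s within {l'..r'})"
    using l r assms Jmem[OF l(2) r(2)]
    by (intro interval_integral_FTC2) (auto intro: continuous_on_subset)
  ultimately show ?thesis
    by (simp add: has_real_derivative_iff_has_vector_derivative)
qed

section \<open>The curvature of helicoidal surfaces of ni-type\<close>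

text \<open>The result depends on \<open>s\<close> only, because the surface is invariant under screw motions about the
  third axis: \<open>X\<^sub>1\<^sub>2\<close> and each \<open>h\<^sub>i\<^sub>j\<close> come out as expressions in \<open>(x, y)\<close> and its derivatives,
  multiplied by \<open>cos\<^sup>2 (t \<phi>) + sin\<^sup>2 (t \<phi>)\<close>. The determinant of the metric is the square of \<open>X\<^sub>1\<^sub>2\<close> by
  Lagrange's identity. The two terms of the numerator come from \<open>h\<^sub>1\<^sub>1 h\<^sub>2\<^sub>2\<close> and \<open>h\<^sub>1\<^sub>2\<^sup>2\<close>.\<close>

lemma helicoidal_ni_curvature:
  fixes x y x1 y1 x2 y2 :: "real \<Rightarrow> real"
  assumes nontriv: "\<And>u. u \<in> J \<Longrightarrow> at u within J \<noteq> bot"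
    and dx: "\<And>u. u \<in> J \<Longrightarrow> (x has_real_derivative x1 u) (at u within J)"
    and dy: "\<And>u. u \<in> J \<Longrightarrow> (y has_real_derivative y1 u) (at u within J)"
    and dx1: "\<And>u. u \<in> J \<Longrightarrow> (x1 has_real_derivative x2 u) (at u within J)"
    and dy1: "\<And>u. u \<in> J \<Longrightarrow> (y1 has_real_derivative y2 u) (at u within J)"
    and "s \<in> J"
  shows "jac (J \<times> UNIV) (helicoidal_ni c \<phi> x y) 1 2 (s, t) = \<phi> * (x s * x1 s + y s * y1 s)"
    and "\<phi> * (x s * x1 s + y s * y1 s) \<noteq> 0 \<Longrightarrow>
      iso_gauss_curvature (J \<times> UNIV) (helicoidal_ni c \<phi> x y) (s, t) =
        c\<^sup>2 * ((x1 s * y2 s - y1 s * x2 s) * (x s * y1 s - y s * x1 s) - ((x1 s)\<^sup>2 + (y1 s)\<^sup>2)\<^sup>2) /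
        (\<phi>\<^sup>2 * (x s * x1 s + y s * y1 s) ^ 4)"
proof -
  define D :: "(real \<times> real) set" where "D = J \<times> UNIV"
  define X where "X = helicoidal_ni c \<phi> x y"
  define C S where "C = cos (t * \<phi>)" and "S = sin (t * \<phi>)"
  have CS: "C\<^sup>2 + S\<^sup>2 = 1" by (simp add: C_def S_def)
  note vd = vector_derivative_within[OF nontriv]
  have slice1: "{u. (u, v) \<in> D} = J" for v
    by (simp add: D_def)
  have slice2: "{v. (u, v) \<in> D} = UNIV" if "u \<in> J" for u
    using that by (simp add: D_def)
  have X1: "pd1 D X (u, v) =
      vector [x1 u * cos (v * \<phi>) - y1 u * sin (v * \<phi>), x1 u * sin (v * \<phi>) + y1 u * cos (v * \<phi>), 0]"
    if "u \<in> J" for u v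
    unfolding pd1_def D_def X_def helicoidal_ni_def using that
    by (auto intro!: vd has_vector_derivative_vector3 derivative_eq_intros dx dy)
  have X2: "pd2 D X (u, v) =
      vector [- \<phi> * (x u * sin (v * \<phi>) + y u * cos (v * \<phi>)),
              \<phi> * (x u * cos (v * \<phi>) - y u * sin (v * \<phi>)), c]"
    if "u \<in> J" for u v
    unfolding pd2_def D_def X_def helicoidal_ni_def using that
    by (auto intro!: vector_derivative_at has_vector_derivative_vector3 derivative_eq_intros simp: algebra_simps)
  have X11: "pd1 D (pd1 D X) (s, t) = vector [x2 s * C - y2 s * S, x2 s * S + y2 s * C, 0]"
  proof -
    have "((\<lambda>u. pd1 D X (u, t)) has_vector_derivative
        vector [x2 s * C - y2 s * S, x2 s * S + y2 s * C, 0]) (at s within J)"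
      using \<open>s \<in> J\<close> X1 unfolding C_def S_def
      by (rule has_vector_derivative_transform)
        (auto intro!: has_vector_derivative_vector3 derivative_eq_intros dx1 dy1 \<open>s \<in> J\<close>)
    then show ?thesis
      using \<open>s \<in> J\<close> by (simp add: pd1_def[of D "pd1 D X"] slice1 vd)
  qed
  have X12: "pd1 D (pd2 D X) (s, t) = vector [- \<phi> * (x1 s * S + y1 s * C), \<phi> * (x1 s * C - y1 s * S), 0]"
  proof -
    have "((\<lambda>u. pd2 D X (u, t)) has_vector_derivative
        vector [- \<phi> * (x1 s * S + y1 s * C), \<phi> * (x1 s * C - y1 s * S), 0]) (at s within J)"
      using \<open>s \<in> J\<close> X2 unfolding C_def S_def
      by (rule has_vector_derivative_transform)
        (auto intro!: has_vector_derivative_vector3 derivative_eq_intros dx dy \<open>s \<in> J\<close> simp: algebra_simps)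
    then show ?thesis
      using \<open>s \<in> J\<close> by (simp add: pd1_def[of D "pd2 D X"] slice1 vd)
  qed
  have X22: "pd2 D (pd2 D X) (s, t) = vector [- \<phi>\<^sup>2 * (x s * C - y s * S), - \<phi>\<^sup>2 * (x s * S + y s * C), 0]"
  proof -
    have "((\<lambda>v. pd2 D X (s, v)) has_vector_derivative
        vector [- \<phi>\<^sup>2 * (x s * C - y s * S), - \<phi>\<^sup>2 * (x s * S + y s * C), 0]) (at t)"
      using \<open>s \<in> J\<close> unfolding C_def S_def
      by (auto intro!: has_vector_derivative_vector3 derivative_eq_intros
          simp: X2 algebra_simps power2_eq_square)
    then show ?thesis
      using \<open>s \<in> J\<close> by (simp add: pd2_def[of D "pd2 D X"] slice2 vector_derivative_at)
  qed
  define P where "P = x s * x1 s + y s * y1 s"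
  \<comment> \<open>The coordinates of the horizontal tangent vector \<open>X\<^sub>1\<close>; the horizontal part of the normal is
    proportional to its rotation by a right angle.\<close>
  define a b where "a = x1 s * C - y1 s * S" and "b = x1 s * S + y1 s * C"
  note X1' = X1[OF \<open>s \<in> J\<close>, of t, folded C_def S_def]
  note X2' = X2[OF \<open>s \<in> J\<close>, of t, folded C_def S_def]
  have "jac D X 1 2 (s, t) = \<phi> * P * (C\<^sup>2 + S\<^sup>2)"
    unfolding jac_def X1' X2' P_def by (simp add: algebra_simps power2_eq_square)
  then have j12: "jac D X 1 2 (s, t) = \<phi> * P" by (simp add: CS)
  then show "jac (J \<times> UNIV) (helicoidal_ni c \<phi> x y) 1 2 (s, t) = \<phi> * (x s * x1 s + y s * y1 s)"
    by (simp add: P_def D_def X_def)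
  have j23: "jac D X 2 3 (s, t) = c * b" and j31: "jac D X 3 1 (s, t) = - c * a"
    unfolding jac_def X1' X2' a_def b_def by (simp_all add: algebra_simps)
  assume "\<phi> * (x s * x1 s + y s * y1 s) \<noteq> 0"
  then have nz: "\<phi> \<noteq> 0" "P \<noteq> 0" by (auto simp: P_def)
  define N where "N = iso_normal D X (s, t)"
  have N: "N = vector [c * b / (\<phi> * P), - c * a / (\<phi> * P), 1]"
    by (simp add: N_def iso_normal_def j12 j23 j31)
  have ip: "N \<bullet> vector [m, n, 0] = c / (\<phi> * P) * (b * m - a * n)" for m n
    unfolding N inner_vec_def sum_3 by (simp add: diff_divide_distrib algebra_simps)
  \<comment> \<open>For a unit speed curve \<open>k\<close> is its plane curvature and \<open>w = 1\<close>.\<close>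
  define k q w where "k = x1 s * y2 s - y1 s * x2 s" and "q = x s * y1 s - y s * x1 s"
    and "w = (x1 s)\<^sup>2 + (y1 s)\<^sup>2"
  have h11: "N \<bullet> pd1 D (pd1 D X) (s, t) = - (c / (\<phi> * P)) * k"
  proof -
    have "b * (x2 s * C - y2 s * S) - a * (x2 s * S + y2 s * C) = - k * (C\<^sup>2 + S\<^sup>2)"
      unfolding a_def b_def k_def by algebra
    then show ?thesis unfolding X11 ip CS by simp
  qed
  have h12: "N \<bullet> pd1 D (pd2 D X) (s, t) = - (c / P) * w"
  proof -
    have "b * (- \<phi> * (x1 s * S + y1 s * C)) - a * (\<phi> * (x1 s * C - y1 s * S)) = - \<phi> * w * (C\<^sup>2 + S\<^sup>2)"
      unfolding a_def b_def w_def by algebra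
    then show ?thesis unfolding X12 ip CS using nz by simp
  qed
  have h22: "N \<bullet> pd2 D (pd2 D X) (s, t) = - (c * \<phi> / P) * q"
  proof -
    have "b * (- \<phi>\<^sup>2 * (x s * C - y s * S)) - a * (- \<phi>\<^sup>2 * (x s * S + y s * C)) = - \<phi>\<^sup>2 * q * (C\<^sup>2 + S\<^sup>2)"
      unfolding a_def b_def q_def by algebra
    then show ?thesis unfolding X22 ip CS using nz by (simp add: power2_eq_square)
  qed
  let ?g = "\<lambda>U V. iso_inner U V"
  have g: "?g (pd1 D X (s, t)) (pd1 D X (s, t)) * ?g (pd2 D X (s, t)) (pd2 D X (s, t)) -
      (?g (pd1 D X (s, t)) (pd2 D X (s, t)))\<^sup>2 = \<phi>\<^sup>2 * P\<^sup>2"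
  proof -
    have "?g U U * ?g V V - (?g U V)\<^sup>2 = (U $ 1 * V $ 2 - U $ 2 * V $ 1)\<^sup>2" for U V
      unfolding iso_inner_def by algebra
    then show ?thesis
      using j12 by (simp add: jac_def power_mult_distrib)
  qed
  have "iso_gauss_curvature D X (s, t) =
      (- (c / (\<phi> * P)) * k * (- (c * \<phi> / P) * q) - (- (c / P) * w)\<^sup>2) / (\<phi>\<^sup>2 * P\<^sup>2)"
    unfolding iso_gauss_curvature_def Let_def N_def[symmetric] h11 h12 h22 g ..
  also have "\<dots> = c\<^sup>2 * (k * q - w\<^sup>2) / (\<phi>\<^sup>2 * P ^ 4)"
    using nz by (simp add: field_simps power2_eq_square power4_eq_xxxx)
  finally show "iso_gauss_curvature (J \<times> UNIV) (helicoidal_ni c \<phi> x y) (s, t) =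
        c\<^sup>2 * ((x1 s * y2 s - y1 s * x2 s) * (x s * y1 s - y s * x1 s) - ((x1 s)\<^sup>2 + (y1 s)\<^sup>2)\<^sup>2) /
        (\<phi>\<^sup>2 * (x s * x1 s + y s * y1 s) ^ 4)"
    by (simp add: P_def k_def q_def w_def D_def X_def)
qed

section \<open>Unit speed curves with prescribed distance from the origin\<close>

text \<open>In complex notation \<open>z = x + \<i> y = sqrt R \<cdot> exp (\<i> \<theta>)\<close> the formula \<open>\<theta>' = q / R\<close> says
  \<open>z' = z (p + \<i> q) / R\<close>. Since \<open>\<bar>z\<bar>\<^sup>2 = R = p\<^sup>2 + q\<^sup>2\<close>, the speed is 1, and \<open>p + \<i> q\<close> is the
  product of \<open>z'\<close> and the conjugate of \<open>z\<close>. Differentiating once more, and using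
  \<open>q q' = p (1 - p')\<close>, gives the Frenet equation \<open>z'' = \<i> k z'\<close> with \<open>k = (1 - p') / q\<close>. The bound
  \<open>p\<^sup>2 < R\<close> is what makes \<open>q\<close> nonzero, hence differentiable, and the curve of class \<open>C\<^sup>2\<close>.\<close>

lemma unit_speed_curve_of_radius:
  fixes R p p1 q \<theta> :: "real \<Rightarrow> real"
  assumes dR: "(R has_real_derivative 2 * p s) (at s within J)"
    and dp: "(p has_real_derivative p1 s) (at s within J)"
    and less: "(p s)\<^sup>2 < R s"
    and d\<theta>: "(\<theta> has_real_derivative q s / R s) (at s within J)"
    and q: "q = (\<lambda>s. sqrt (R s - (p s)\<^sup>2))"
    and x: "x = (\<lambda>s. sqrt (R s) * cos (\<theta> s))"
    and y: "y = (\<lambda>s. sqrt (R s) * sin (\<theta> s))"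
    and x1: "x1 = (\<lambda>s. (p s * x s - q s * y s) / R s)"
    and y1: "y1 = (\<lambda>s. (p s * y s + q s * x s) / R s)"
    and k: "k = (\<lambda>s. (1 - p1 s) / q s)"
  shows "(x has_real_derivative x1 s) (at s within J)"
    and "(y has_real_derivative y1 s) (at s within J)"
    and "(x1 has_real_derivative - k s * y1 s) (at s within J)"
    and "(y1 has_real_derivative k s * x1 s) (at s within J)"
    and "(x s)\<^sup>2 + (y s)\<^sup>2 = R s"
    and "(x1 s)\<^sup>2 + (y1 s)\<^sup>2 = 1"
    and "x s * x1 s + y s * y1 s = p s"
    and "x s * y1 s - y s * x1 s = q s"
proof -
  have Rpos: "0 < R s" using less zero_le_power2[of "p s"] by linarith
  have qpos: "0 < q s" using less by (simp add: q)
  have Rpq: "R s = (p s)\<^sup>2 + (q s)\<^sup>2" using less by (simp add: q)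
  have sq: "sqrt (R s) * sqrt (R s) = R s" using Rpos by simp
  show xy: "(x s)\<^sup>2 + (y s)\<^sup>2 = R s"
    using Rpos by (simp add: x y power_mult_distrib flip: distrib_left)
  show "x s * x1 s + y s * y1 s = p s"
  proof -
    have "x s * x1 s + y s * y1 s = p s * ((x s)\<^sup>2 + (y s)\<^sup>2) / R s"
      unfolding x1 y1 using Rpos by (simp add: field_simps power2_eq_square)
    then show ?thesis using xy Rpos by simp
  qed
  show "x s * y1 s - y s * x1 s = q s"
  proof -
    have "x s * y1 s - y s * x1 s = q s * ((x s)\<^sup>2 + (y s)\<^sup>2) / R s"
      unfolding x1 y1 using Rpos by (simp add: field_simps power2_eq_square)
    then show ?thesis using xy Rpos by simp
  qed
  show "(x1 s)\<^sup>2 + (y1 s)\<^sup>2 = 1"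
  proof -
    have "(x1 s)\<^sup>2 + (y1 s)\<^sup>2 = ((p s)\<^sup>2 + (q s)\<^sup>2) * ((x s)\<^sup>2 + (y s)\<^sup>2) / (R s)\<^sup>2"
      unfolding x1 y1 using Rpos by (simp add: field_simps power2_eq_square)
    then show ?thesis using xy Rpos by (simp add: Rpq[symmetric]) (simp add: power2_eq_square)
  qed
  have dsq: "((\<lambda>s. sqrt (R s)) has_real_derivative p s / R s * sqrt (R s)) (at s within J)"
    using Rpos sq by (auto intro!: derivative_eq_intros dR simp: field_simps)
  show dx: "(x has_real_derivative x1 s) (at s within J)"
    unfolding x x1 y
    by (rule derivative_eq_intros dsq d\<theta> refl)+ (use Rpos in \<open>simp add: field_simps\<close>)
  show dy: "(y has_real_derivative y1 s) (at s within J)"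
    unfolding x y1 y
    by (rule derivative_eq_intros dsq d\<theta> refl)+ (use Rpos in \<open>simp add: field_simps\<close>)
  have dq: "(q has_real_derivative p s * k s) (at s within J)"
    unfolding q k using less
    by (auto intro!: derivative_eq_intros dR dp simp: field_simps)
  have p1_eq: "p1 s = 1 - k s * q s" using qpos by (simp add: k)
  have Rnz: "R s \<noteq> 0" using Rpos by simp
  show "(x1 has_real_derivative - k s * y1 s) (at s within J)"
    by (rule DERIV_cong[OF DERIV_divide[OF DERIV_diff[OF DERIV_mult[OF dp dx] DERIV_mult[OF dq dy]] dR Rnz, folded x1 y1]],
        unfold x1 y1 p1_eq, use Rpos in \<open>simp add: field_simps\<close>, use Rpq in algebra)
  show "(y1 has_real_derivative k s * x1 s) (at s within J)"
    by (rule DERIV_cong[OF DERIV_divide[OF DERIV_add[OF DERIV_mult[OF dp dy] DERIV_mult[OF dq dx]] dR Rnz, folded x1 y1]],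
        unfold x1 y1 p1_eq, use Rpos in \<open>simp add: field_simps\<close>, use Rpq in algebra)
qed

section \<open>The two integrations\<close>

lemma radicand_has_derivative:
  assumes "is_interval J" "continuous_on J K" "s0 \<in> J" "s \<in> J"
  shows "(radicand c \<phi> K s0 k1 has_real_derivative 3 * \<phi>\<^sup>2 / c\<^sup>2 * K s) (at s within J)"
  unfolding radicand_def[abs_def]
  by (rule derivative_eq_intros oriented_integral_has_derivative assms refl)+ simp

text \<open>This is the differential equation \<open>- c\<^sup>2 p' / (\<phi>\<^sup>2 p\<^sup>4) = K\<close>, whose left-hand side is the
  curvature of the surface.\<close>

lemma slope_has_derivative:
  assumes "is_interval J" "continuous_on J K" "s0 \<in> J" "s \<in> J"
    and "radicand c \<phi> K s0 k1 s \<noteq> 0"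
  defines "p \<equiv> \<lambda>s. 1 / root 3 (radicand c \<phi> K s0 k1 s)"
  shows "(p has_real_derivative - (\<phi>\<^sup>2 / c\<^sup>2 * K s * p s ^ 4)) (at s within J)"
proof -
  define r where "r = radicand c \<phi> K s0 k1"
  define m where "m = 3 * \<phi>\<^sup>2 / c\<^sup>2 * K s"
  have root_nz: "root 3 (r s) \<noteq> 0"
    using assms(5) by (simp add: r_def)
  have "odd (3 :: nat)" by simp
  from DERIV_odd_real_root[OF this]
  have "(root 3 has_real_derivative inverse (real 3 * root 3 (r s) ^ (3 - Suc 0))) (at (r s))"
    using assms(5) unfolding r_def .
  moreover have "(r has_real_derivative m) (at s within J)"
    unfolding r_def m_def by (rule radicand_has_derivative[OF assms(1-4)])
  ultimately
  have "((\<lambda>s. root 3 (r s)) has_real_derivative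
      inverse (real 3 * root 3 (r s) ^ (3 - Suc 0)) * m) (at s within J)"
    by (rule DERIV_chain2)
  from DERIV_inverse'[OF this root_nz]
  have "((\<lambda>s. inverse (root 3 (r s))) has_real_derivative - (\<phi>\<^sup>2 / c\<^sup>2 * K s * inverse (root 3 (r s)) ^ 4))
      (at s within J)"
  proof (rule DERIV_cong)
    have "- (inverse w * (inverse (real 3 * w ^ (3 - Suc 0)) * m) * inverse w) =
        - (\<phi>\<^sup>2 / c\<^sup>2 * K s * inverse w ^ 4)" for w :: real
    proof -
      have "inverse (real 3 * w ^ (3 - Suc 0)) * m = \<phi>\<^sup>2 / c\<^sup>2 * K s * (inverse w * inverse w)"
        by (simp add: m_def numeral_eq_Suc)
      then show ?thesis
        by (simp only: power4_eq_xxxx mult_ac)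
    qed
    then show "- (inverse (root 3 (r s)) * (inverse (real 3 * root 3 (r s) ^ (3 - Suc 0)) * m) *
        inverse (root 3 (r s))) = - (\<phi>\<^sup>2 / c\<^sup>2 * K s * inverse (root 3 (r s)) ^ 4)" .
  qed
  then show ?thesis
    by (simp only: p_def r_def inverse_eq_divide)
qed

lemma slope_continuous_on:
  assumes "is_interval J" "continuous_on J K" "s0 \<in> J"
    and "\<And>s. s \<in> J \<Longrightarrow> radicand c \<phi> K s0 k1 s \<noteq> 0"
  shows "continuous_on J (\<lambda>s. 1 / root 3 (radicand c \<phi> K s0 k1 s))"
  using slope_has_derivative[OF assms(1-3) _ assms(4)] by (rule DERIV_continuous_on)

lemma radius_sq_has_derivative:
  assumes "is_interval J" "continuous_on J K" "s0 \<in> J" "s \<in> J"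
    and "\<And>s. s \<in> J \<Longrightarrow> radicand c \<phi> K s0 k1 s \<noteq> 0"
  shows "(radius_sq c \<phi> K s0 k0 k1 has_real_derivative
    2 * (1 / root 3 (radicand c \<phi> K s0 k1 s))) (at s within J)"
proof -
  have "((\<lambda>s. LBINT v=s0..s. 1 / root 3 (radicand c \<phi> K s0 k1 v)) has_real_derivative
      1 / root 3 (radicand c \<phi> K s0 k1 s)) (at s within J)"
    using assms by (intro oriented_integral_has_derivative slope_continuous_on)
  from DERIV_add[OF DERIV_const DERIV_cmult[OF this, of 2]] show ?thesis
    by (simp add: radius_sq_def[abs_def])
qed

text \<open>The radicand being nonzero and the strict Cauchy--Schwarz bound hold at \<open>s0\<close> and are open
  conditions. They are secured one after the other, because the continuity of \<open>radius_sq\<close> comes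
  from that of its integrand, where the radicand has no zero.\<close>

lemma sensible_interval_exists:
  assumes "is_interval I" and "s0 \<in> I" and "I \<noteq> {s0}" and "continuous_on I K"
    and "k1 \<noteq> 0" and "(1 / root 3 k1)\<^sup>2 < k0"
  shows "\<exists>J. openin (top_of_set I) J \<and> sensible_interval c \<phi> K I s0 k0 k1 J"
proof -
  let ?r = "radicand c \<phi> K s0 k1" and ?R = "radius_sq c \<phi> K s0 k0 k1"
  have ball_interval: "is_interval (I \<inter> ball s0 d)" for d
    using assms(1) by (intro is_interval_Int) (auto simp: is_interval_ball_real)
  have "continuous_on I ?r"
    using radicand_has_derivative[OF assms(1,4,2)] by (rule DERIV_continuous_on)
  moreover have r0: "?r s0 = k1" by (simp add: radicand_def)
  ultimately obtain d where "0 < d" and d: "\<And>s. s \<in> I \<Longrightarrow> dist s s0 < d \<Longrightarrow> ?r s \<noteq> 0"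
    using continuous_on_avoid[of I ?r s0 0] \<open>k1 \<noteq> 0\<close> \<open>s0 \<in> I\<close> by (metis dist_commute)
  define J where "J = I \<inter> ball s0 d"
  have J: "is_interval J" "s0 \<in> J" "continuous_on J K"
    and rJ: "\<And>s. s \<in> J \<Longrightarrow> ?r s \<noteq> 0"
    using ball_interval \<open>0 < d\<close> assms(2,4) d
    by (auto simp: J_def dist_commute intro: continuous_on_subset)
  have "continuous_on J (\<lambda>s. ?R s - (1 / root 3 (?r s))\<^sup>2)"
    by (intro continuous_on_diff continuous_on_power slope_continuous_on[OF J(1,3,2) rJ]
        DERIV_continuous_on[OF radius_sq_has_derivative[OF J(1,3,2) _ rJ]])
  then obtain e where "0 < e" and e: "\<And>s. s \<in> J \<Longrightarrow> dist s s0 < e \<Longrightarrow>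
      dist (?R s - (1 / root 3 (?r s))\<^sup>2) (?R s0 - (1 / root 3 (?r s0))\<^sup>2) < k0 - (1 / root 3 k1)\<^sup>2"
    using J(2) assms(6) unfolding continuous_on_iff by (metis diff_gt_0_iff_gt)
  have less: "(1 / root 3 (?r s))\<^sup>2 < ?R s" if "s \<in> J" "dist s s0 < e" for s
    using e[OF that] r0 by (simp add: radius_sq_def dist_real_def abs_if split: if_splits)
  define J' where "J' = I \<inter> ball s0 (min d e)"
  have "J' \<noteq> {s0}"
  proof
    assume "J' = {s0}"
    then have "\<not> s0 islimpt I"
      using \<open>0 < d\<close> \<open>0 < e\<close> by (auto simp: J'_def islimpt_def intro!: exI[of _ "ball s0 (min d e)"])
    then show False
      using is_interval_perfect[OF assms(1,2,3,2)] by (simp add: trivial_limit_within)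
  qed
  moreover have "openin (top_of_set I) J'"
    by (auto simp: J'_def)
  ultimately have "openin (top_of_set I) J' \<and> sensible_interval c \<phi> K I s0 k0 k1 J'"
    using ball_interval[of "min d e"] \<open>0 < d\<close> \<open>0 < e\<close> assms(2) rJ less
    by (auto simp: sensible_interval_def J'_def J_def dist_commute)
  then show ?thesis ..
qed

section \<open>Helicoidal surfaces with prescribed Gaussian curvature\<close>

theorem theorem5p2:
  fixes c \<phi> s0 :: real and K :: "real \<Rightarrow> real" and I :: "real set"
  assumes "c \<noteq> 0" and "\<phi> \<noteq> 0"
    and "is_interval I" and "s0 \<in> I" and "I \<noteq> {s0}"
    and "continuous_on I K"
  shows "(\<forall>k0 k1. k1 \<noteq> 0 \<and> (1 / root 3 k1)\<^sup>2 < k0 \<longrightarrow>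
            (\<exists>J. openin (top_of_set I) J \<and> sensible_interval c \<phi> K I s0 k0 k1 J)) \<and>
         (\<exists>x y :: real \<Rightarrow> real \<Rightarrow> real \<Rightarrow> real.
            \<forall>k0 k1 J. sensible_interval c \<phi> K I s0 k0 k1 J \<longrightarrow>
              C2_on J (x k0 k1) \<and> C2_on J (y k0 k1) \<and>
              arclength_param J (x k0 k1) (y k0 k1) \<and>
              iso_admissible (J \<times> UNIV) (helicoidal_ni c \<phi> (x k0 k1) (y k0 k1)) \<and>
              (\<forall>s\<in>J. \<forall>t. iso_gauss_curvature (J \<times> UNIV)
                 (helicoidal_ni c \<phi> (x k0 k1) (y k0 k1)) (s, t) = K s) \<and>
              (\<forall>s\<in>J. (x k0 k1 s)\<^sup>2 + (y k0 k1 s)\<^sup>2 =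
                 k0 + 2 * (LBINT v=s0..s.
                   1 / root 3 (k1 + 3 * \<phi>\<^sup>2 / c\<^sup>2 * (LBINT w=s0..v. K w)))) \<and>
              k0 = (x k0 k1 s0)\<^sup>2 + (y k0 k1 s0)\<^sup>2 \<and>
              k1 = 1 / (x k0 k1 s0 * vector_derivative (x k0 k1) (at s0 within J) +
                        y k0 k1 s0 * vector_derivative (y k0 k1) (at s0 within J)) ^ 3)"
proof (intro conjI)
  show "\<forall>k0 k1. k1 \<noteq> 0 \<and> (1 / root 3 k1)\<^sup>2 < k0 \<longrightarrow>
      (\<exists>J. openin (top_of_set I) J \<and> sensible_interval c \<phi> K I s0 k0 k1 J)"
    using sensible_interval_exists[OF assms(3-6)] by simp
next
  define p where "p k1 s = 1 / root 3 (radicand c \<phi> K s0 k1 s)" for k1 s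
  define R where "R k0 k1 = radius_sq c \<phi> K s0 k0 k1" for k0 k1
  define q where "q k0 k1 = (\<lambda>s. sqrt (R k0 k1 s - (p k1 s)\<^sup>2))" for k0 k1
  define \<theta> where "\<theta> k0 k1 s = (LBINT v=s0..s. q k0 k1 v / R k0 k1 v)" for k0 k1 and s :: real
  define x where "x k0 k1 = (\<lambda>s. sqrt (R k0 k1 s) * cos (\<theta> k0 k1 s))" for k0 k1
  define y where "y k0 k1 = (\<lambda>s. sqrt (R k0 k1 s) * sin (\<theta> k0 k1 s))" for k0 k1
  show "\<exists>x y :: real \<Rightarrow> real \<Rightarrow> real \<Rightarrow> real.
            \<forall>k0 k1 J. sensible_interval c \<phi> K I s0 k0 k1 J \<longrightarrow>
              C2_on J (x k0 k1) \<and> C2_on J (y k0 k1) \<and>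
              arclength_param J (x k0 k1) (y k0 k1) \<and>
              iso_admissible (J \<times> UNIV) (helicoidal_ni c \<phi> (x k0 k1) (y k0 k1)) \<and>
              (\<forall>s\<in>J. \<forall>t. iso_gauss_curvature (J \<times> UNIV)
                 (helicoidal_ni c \<phi> (x k0 k1) (y k0 k1)) (s, t) = K s) \<and>
              (\<forall>s\<in>J. (x k0 k1 s)\<^sup>2 + (y k0 k1 s)\<^sup>2 =
                 k0 + 2 * (LBINT v=s0..s.
                   1 / root 3 (k1 + 3 * \<phi>\<^sup>2 / c\<^sup>2 * (LBINT w=s0..v. K w)))) \<and>
              k0 = (x k0 k1 s0)\<^sup>2 + (y k0 k1 s0)\<^sup>2 \<and>
              k1 = 1 / (x k0 k1 s0 * vector_derivative (x k0 k1) (at s0 within J) +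
                        y k0 k1 s0 * vector_derivative (y k0 k1) (at s0 within J)) ^ 3"
  proof (rule exI[of _ x], rule exI[of _ y], intro allI impI)
    fix k0 k1 J
    assume sens: "sensible_interval c \<phi> K I s0 k0 k1 J"
    then have J: "is_interval J" "s0 \<in> J" "J \<noteq> {s0}" and contK: "continuous_on J K"
      and r: "\<And>s. s \<in> J \<Longrightarrow> radicand c \<phi> K s0 k1 s \<noteq> 0"
      and less: "\<And>s. s \<in> J \<Longrightarrow> (p k1 s)\<^sup>2 < R k0 k1 s"
      using continuous_on_subset[OF assms(6)]
      by (simp_all add: sensible_interval_def p_def R_def)
    note nontriv = is_interval_perfect[OF J(1,2,3)]
    \<comment> \<open>The expected derivatives: \<open>p1 = p'\<close>, \<open>x1 = x'\<close>, \<open>y1 = y'\<close>, and \<open>\<kappa>\<close> is the plane curvature.\<close>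
    define p1 where "p1 s = - (\<phi>\<^sup>2 / c\<^sup>2 * K s * p k1 s ^ 4)" for s
    define x1 where "x1 = (\<lambda>s. (p k1 s * x k0 k1 s - q k0 k1 s * y k0 k1 s) / R k0 k1 s)"
    define y1 where "y1 = (\<lambda>s. (p k1 s * y k0 k1 s + q k0 k1 s * x k0 k1 s) / R k0 k1 s)"
    define \<kappa> where "\<kappa> = (\<lambda>s. (1 - p1 s) / q k0 k1 s)"
    have dR: "(R k0 k1 has_real_derivative 2 * p k1 s) (at s within J)" if "s \<in> J" for s
      unfolding R_def p_def using radius_sq_has_derivative[OF J(1) contK J(2) that r] .
    have dp: "(p k1 has_real_derivative p1 s) (at s within J)" if "s \<in> J" for s
      unfolding p_def[abs_def] p1_def
      using slope_has_derivative[OF J(1) contK J(2) that r[OF that]] .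
    have Rpos: "0 < R k0 k1 s" and qpos: "0 < q k0 k1 s" if "s \<in> J" for s
      using less[OF that] order.strict_trans1[OF zero_le_power2 less[OF that]] by (auto simp: q_def)
    have contp: "continuous_on J (p k1)" and contR: "continuous_on J (R k0 k1)"
      by (rule DERIV_continuous_on[OF dp] DERIV_continuous_on[OF dR]; assumption)+
    have contq: "continuous_on J (q k0 k1)"
      unfolding q_def by (intro continuous_intros contp contR)
    have d\<theta>: "(\<theta> k0 k1 has_real_derivative q k0 k1 s / R k0 k1 s) (at s within J)" if "s \<in> J" for s
      unfolding \<theta>_def[abs_def] using Rpos
      by (intro oriented_integral_has_derivative J that continuous_on_divide contq contR)
        (auto simp: less_le)
    have dx: "(x k0 k1 has_real_derivative x1 s) (at s within J)"
      and dy: "(y k0 k1 has_real_derivative y1 s) (at s within J)"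
      and dx1: "(x1 has_real_derivative - \<kappa> s * y1 s) (at s within J)"
      and dy1: "(y1 has_real_derivative \<kappa> s * x1 s) (at s within J)"
      and radius: "(x k0 k1 s)\<^sup>2 + (y k0 k1 s)\<^sup>2 = R k0 k1 s"
      and unit_speed: "(x1 s)\<^sup>2 + (y1 s)\<^sup>2 = 1"
      and slope: "x k0 k1 s * x1 s + y k0 k1 s * y1 s = p k1 s"
      and cross: "x k0 k1 s * y1 s - y k0 k1 s * x1 s = q k0 k1 s" if "s \<in> J" for s
      by (rule unit_speed_curve_of_radius[OF dR[OF that] dp[OF that] less[OF that] d\<theta>[OF that]
          q_def x_def y_def x1_def y1_def \<kappa>_def])+
    have cont\<kappa>: "continuous_on J \<kappa>"
      unfolding \<kappa>_def p1_def using qpos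
      by (intro continuous_intros contK contp contq) (auto simp: less_le)
    have contx1: "continuous_on J x1" and conty1: "continuous_on J y1"
      by (rule DERIV_continuous_on[OF dx1] DERIV_continuous_on[OF dy1]; assumption)+
    have vdx: "vector_derivative (x k0 k1) (at s within J) = x1 s"
      and vdy: "vector_derivative (y k0 k1) (at s within J) = y1 s" if "s \<in> J" for s
      using dx dy that nontriv
      by (auto intro!: vector_derivative_within simp flip: has_real_derivative_iff_has_vector_derivative)
    have pnz: "p k1 s \<noteq> 0" if "s \<in> J" for s
      using r[OF that] by (simp add: p_def)
    have p0: "p k1 s0 = 1 / root 3 k1" by (simp add: p_def radicand_def)
    have "continuous_on J (\<lambda>s. - \<kappa> s * y1 s)" "continuous_on J (\<lambda>s. \<kappa> s * x1 s)"
      by (intro continuous_intros cont\<kappa> contx1 conty1)+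
    then have "C2_on J (x k0 k1)" "C2_on J (y k0 k1)"
      unfolding C2_on_def has_real_derivative_iff_has_vector_derivative[symmetric]
      using dx dx1 dy dy1 by (fast, fast)
    moreover have "arclength_param J (x k0 k1) (y k0 k1)"
      by (simp add: arclength_param_def vdx vdy unit_speed)
    moreover have "jac (J \<times> UNIV) (helicoidal_ni c \<phi> (x k0 k1) (y k0 k1)) 1 2 (s, t) = \<phi> * p k1 s"
      if "s \<in> J" for s t
      by (subst helicoidal_ni_curvature(1)[OF nontriv dx dy dx1 dy1 that]) (simp_all add: slope that)
    then have "iso_admissible (J \<times> UNIV) (helicoidal_ni c \<phi> (x k0 k1) (y k0 k1))"
      using assms(2) pnz by (auto simp: iso_admissible_def)
    moreover have "iso_gauss_curvature (J \<times> UNIV) (helicoidal_ni c \<phi> (x k0 k1) (y k0 k1)) (s, t) = K s"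
      if s: "s \<in> J" for s t
    proof -
      have "x1 s * (\<kappa> s * x1 s) + y1 s * (\<kappa> s * y1 s) = \<kappa> s * ((x1 s)\<^sup>2 + (y1 s)\<^sup>2)"
        by (simp add: algebra_simps power2_eq_square)
      then have curv: "x1 s * (\<kappa> s * x1 s) + y1 s * (\<kappa> s * y1 s) = \<kappa> s"
        by (simp add: unit_speed[OF s])
      have "iso_gauss_curvature (J \<times> UNIV) (helicoidal_ni c \<phi> (x k0 k1) (y k0 k1)) (s, t) =
          c\<^sup>2 * (\<kappa> s * q k0 k1 s - 1) / (\<phi>\<^sup>2 * p k1 s ^ 4)"
        using assms(2) pnz[OF s]
        by (subst helicoidal_ni_curvature(2)[OF nontriv dx dy dx1 dy1 s])
          (simp_all add: unit_speed[OF s] slope[OF s] cross[OF s] curv)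
      also have "\<dots> = K s"
        using assms(1,2) pnz[OF s] qpos[OF s] by (simp add: \<kappa>_def p1_def field_simps)
      finally show ?thesis .
    qed
    moreover have "(x k0 k1 s)\<^sup>2 + (y k0 k1 s)\<^sup>2 = k0 + 2 * (LBINT v=s0..s.
        1 / root 3 (k1 + 3 * \<phi>\<^sup>2 / c\<^sup>2 * (LBINT w=s0..v. K w)))" if "s \<in> J" for s
      unfolding radius[OF that] by (simp add: R_def radius_sq_def radicand_def)
    moreover have "k0 = (x k0 k1 s0)\<^sup>2 + (y k0 k1 s0)\<^sup>2"
      unfolding radius[OF J(2)] by (simp add: R_def radius_sq_def)
    moreover have "k1 = 1 / (x k0 k1 s0 * vector_derivative (x k0 k1) (at s0 within J) +
        y k0 k1 s0 * vector_derivative (y k0 k1) (at s0 within J)) ^ 3"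
      unfolding vdx[OF J(2)] vdy[OF J(2)] slope[OF J(2)] p0
      by (simp add: power_divide odd_real_root_pow)
    ultimately show "C2_on J (x k0 k1) \<and> C2_on J (y k0 k1) \<and>
              arclength_param J (x k0 k1) (y k0 k1) \<and>
              iso_admissible (J \<times> UNIV) (helicoidal_ni c \<phi> (x k0 k1) (y k0 k1)) \<and>
              (\<forall>s\<in>J. \<forall>t. iso_gauss_curvature (J \<times> UNIV)
                 (helicoidal_ni c \<phi> (x k0 k1) (y k0 k1)) (s, t) = K s) \<and>
              (\<forall>s\<in>J. (x k0 k1 s)\<^sup>2 + (y k0 k1 s)\<^sup>2 =
                 k0 + 2 * (LBINT v=s0..s.
                   1 / root 3 (k1 + 3 * \<phi>\<^sup>2 / c\<^sup>2 * (LBINT w=s0..v. K w)))) \<and>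
              k0 = (x k0 k1 s0)\<^sup>2 + (y k0 k1 s0)\<^sup>2 \<and>
              k1 = 1 / (x k0 k1 s0 * vector_derivative (x k0 k1) (at s0 within J) +
                        y k0 k1 s0 * vector_derivative (y k0 k1) (at s0 within J)) ^ 3"
      by blast
  qed
qed

end
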